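(* Let $X$ be a topological space. Then $\mathcal{M}$, the assignment sending each open subset $U\subset X$ to the set $\mathcal{M}(U)$ of Borel measures on $U$ together with restriction of measures, is a presheaf of sets on $X$.
   Context: For an open subset $U\subset X$, $\mathcal{M}(U)=\{\mu:\mathcal{B}(U)\to[0,\infty]\mid\mu\text{ is a Borel measure}\}$, where $\mathcal{B}(U)$ is the Borel $\sigma$-algebra of $U$. For open $V\subset U$ the restriction map $\rho^U_V:\mathcal{M}(U)\to\mathcal{M}(V)$ is $\mu\mapsto\mu|_V$, $\mu|_V(B)=\mu(B)$ for Borel $B\subset V$. A presheaf of sets on $X$ is a contravariant functor from the poset of open subsets of $X$ (ordered by inclusion) to sets. *)

theory Defs
  imports "HOL-Analysis.Analysis"
begin

text \<open>A presheaf of sets on \<open>X\<close>: a functor on the opposite of the poset of open sets of \<open>X\<close>. The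
  poset has exactly one arrow \<open>V \<rightarrow> U\<close> when \<open>V \<subseteq> U\<close>, and \<open>\<rho> U V\<close> is its image. A map between
  sets is a function that matters only on its domain, so equality of maps is tested there.\<close>

locale presheaf_of_sets =
  fixes X :: "'a topology"
    and F :: "'a set \<Rightarrow> 'b set"
    and \<rho> :: "'a set \<Rightarrow> 'a set \<Rightarrow> 'b \<Rightarrow> 'b"
  assumes maps: "\<lbrakk>openin X U; openin X V; V \<subseteq> U\<rbrakk> \<Longrightarrow> \<rho> U V \<in> F U \<rightarrow> F V"
    and ident: "\<lbrakk>openin X U; s \<in> F U\<rbrakk> \<Longrightarrow> \<rho> U U s = s"
    and comp: "\<lbrakk>openin X U; openin X V; openin X W; W \<subseteq> V; V \<subseteq> U; s \<in> F U\<rbrakk>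
      \<Longrightarrow> \<rho> V W (\<rho> U V s) = \<rho> U W s"

definition borel_algebra :: "'a topology \<Rightarrow> 'a set \<Rightarrow> 'a set set" where
  "borel_algebra X U = sigma_sets U {W. openin (subtopology X U) W}"

text \<open>Measures are functions defined exactly on the Borel sets: they are extensional, so that two of
  them are equal iff they agree on \<open>borel_algebra X U\<close>. Unlike \<^typ>\<open>'a measure\<close> with
  \<^const>\<open>restrict_space\<close>, where a set function that fails to be a measure is replaced by \<open>0\<close>, this
  makes the restriction below literally the restriction of functions.\<close>

definition borel_measures :: "'a topology \<Rightarrow> 'a set \<Rightarrow> ('a set \<Rightarrow> ennreal) set" where
  "borel_measures X U =
    {\<mu> \<in> borel_algebra X U \<rightarrow>\<^sub>E UNIV. measure_space U (borel_algebra X U) \<mu>}"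

definition restrict_borel_measure ::
    "'a topology \<Rightarrow> 'a set \<Rightarrow> 'a set \<Rightarrow> ('a set \<Rightarrow> ennreal) \<Rightarrow> ('a set \<Rightarrow> ennreal)" where
  "restrict_borel_measure X U V \<mu> = restrict \<mu> (borel_algebra X V)"

end

theory Submission imports Defs begin

text \<open>Restricting functions to smaller domains is functorial, so the identity and composition
  laws come down to facts about domains. The substance is that the domains are nested: for
  \<open>V\<close> open in \<open>X\<close> and contained in \<open>U\<close>, every Borel set of
  \<open>V\<close> is a Borel set of \<open>U\<close> (\<open>borel_algebra_mono\<close>). Hence a
  measure on \<open>U\<close> has values on all Borel sets of \<open>V\<close>, and it stays a
  measure there because sums and unions are unchanged
  (\<open>restrict_borel_measure_in_borel_measures\<close>).\<close>

lemma sigma_algebra_borel_algebra: "sigma_algebra U (borel_algebra X U)"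
  unfolding borel_algebra_def
  by (rule sigma_algebra_sigma_sets) (auto dest: openin_imp_subset)

lemma openin_in_borel_algebra:
  assumes "openin X W" "W \<subseteq> U"
  shows "W \<in> borel_algebra X U"
proof -
  have "openin (subtopology X U) W"
    unfolding openin_subtopology using assms by blast
  then show ?thesis
    unfolding borel_algebra_def by (simp add: sigma_sets.Basic)
qed

text \<open>Induction over the generation of the smaller algebra. Openness of \<open>V\<close>
  enters twice: it makes relatively open subsets of \<open>V\<close> open in \<open>X\<close>, and
  it makes \<open>V\<close> itself Borel in \<open>U\<close>.\<close>

lemma borel_algebra_mono:
  assumes V: "openin X V" and "V \<subseteq> U"
  shows "borel_algebra X V \<subseteq> borel_algebra X U"
proof
  interpret U: sigma_algebra U "borel_algebra X U"
    by (rule sigma_algebra_borel_algebra)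
  fix B assume "B \<in> borel_algebra X V"
  then have "B \<in> sigma_sets V {W. openin (subtopology X V) W}"
    by (simp add: borel_algebra_def)
  then show "B \<in> borel_algebra X U"
  proof induction
    case (Basic W)
    then have "openin X W" "W \<subseteq> V"
      using V by (auto simp: openin_open_subtopology)
    then show ?case
      using \<open>V \<subseteq> U\<close> by (intro openin_in_borel_algebra) auto
  next
    \<comment> \<open>The complement is taken in \<open>V\<close>, not in \<open>U\<close>, so it is
      handled as the difference \<open>V - B\<close> of two Borel sets of \<open>U\<close>.\<close>
    case (Compl B)
    then show ?case
      using openin_in_borel_algebra[OF V \<open>V \<subseteq> U\<close>] by blast
  qed auto
qed

text \<open>A disjoint sequence in the smaller algebra is also one in the larger, where
  \<open>\<mu>\<close> is already countably additive.\<close>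

lemma restrict_borel_measure_in_borel_measures:
  assumes "openin X V" "V \<subseteq> U" "\<mu> \<in> borel_measures X U"
  shows "restrict_borel_measure X U V \<mu> \<in> borel_measures X V"
proof -
  interpret V: sigma_algebra V "borel_algebra X V"
    by (rule sigma_algebra_borel_algebra)
  have sub: "borel_algebra X V \<subseteq> borel_algebra X U"
    using assms(1,2) by (rule borel_algebra_mono)
  have pos: "positive (borel_algebra X U) \<mu>" and add: "countably_additive (borel_algebra X U) \<mu>"
    using assms(3) by (auto simp: borel_measures_def measure_space_def)
  let ?\<nu> = "restrict \<mu> (borel_algebra X V)"
  have "positive (borel_algebra X V) ?\<nu>"
    using pos by (simp add: positive_def)
  moreover have "countably_additive (borel_algebra X V) ?\<nu>"
  proof (rule countably_additiveI)
    fix A :: "nat \<Rightarrow> 'a set"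
    assume A: "range A \<subseteq> borel_algebra X V" "disjoint_family A" "\<Union>(range A) \<in> borel_algebra X V"
    then have "(\<Sum>i. \<mu> (A i)) = \<mu> (\<Union>(range A))"
      using sub by (intro add[unfolded countably_additive_def, rule_format]) auto
    moreover have "?\<nu> (A i) = \<mu> (A i)" for i
      using A(1) by auto
    ultimately show "(\<Sum>i. ?\<nu> (A i)) = ?\<nu> (\<Union>(range A))"
      using A(3) by simp
  qed
  ultimately show ?thesis
    unfolding borel_measures_def restrict_borel_measure_def measure_space_def
    using V.sigma_algebra_axioms by auto
qed

theorem lemma3p2:
  fixes X :: "'a topology"
  shows "presheaf_of_sets X (borel_measures X) (restrict_borel_measure X)"
proof
  fix U V assume "openin X U" "openin X V" "V \<subseteq> U"
  then show "restrict_borel_measure X U V \<in> borel_measures X U \<rightarrow> borel_measures X V"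
    by (auto intro: restrict_borel_measure_in_borel_measures)
next
  fix U \<mu> assume "\<mu> \<in> borel_measures X U"
  \<comment> \<open>Extensionality gives equality of the total functions, also off the Borel
    sets.\<close>
  then show "restrict_borel_measure X U U \<mu> = \<mu>"
    by (auto simp: borel_measures_def restrict_borel_measure_def PiE_def extensional_restrict)
next
  fix U V W \<mu> assume "openin X W" "W \<subseteq> V"
  \<comment> \<open>Restricting twice is restricting to the intersection of the two domains.\<close>
  then have "borel_algebra X V \<inter> borel_algebra X W = borel_algebra X W"
    using borel_algebra_mono by blast
  then show "restrict_borel_measure X V W (restrict_borel_measure X U V \<mu>)
      = restrict_borel_measure X U W \<mu>"
    by (simp add: restrict_borel_measure_def)
qed

end
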